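(* Let $\{(\mathbf{x}_i,y_i)\}_{i=1}^n$ be independent observations from the $k$-sample linear regression model described in the context, and suppose that for every $1\le j\le k$ the sample size $n_j$ is divisible by the window size $n_0$. Then the EM estimator $\hat{\bm{\beta}}_{\mathrm{EM}}$ admits an explicit closed-form solution, given by $$\hat{\bm{\beta}}_{\mathrm{EM}}=\bm{\beta}+\Bigl[\sum_{j=1}^{T}\sum_{i=1+(j-1)n_0}^{jn_0}(\mathbf{x}_i-\bar{\mathbf{x}}_j)(\mathbf{x}_i-\bar{\mathbf{x}}_j)^{\top}\Bigr]^{-1}\sum_{j=1}^{T}\sum_{i=1+(j-1)n_0}^{jn_0}(\mathbf{x}_i-\bar{\mathbf{x}}_j)\varepsilon_i,$$ where $\bar{\mathbf{x}}_j=\frac1{n_0}\sum_{i=1+(j-1)n_0}^{jn_0}\mathbf{x}_i$ for $1\le j\le T$.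
   Context: Model. The observations satisfy $y_i=\mathbf{x}_i^{\top}\bm{\beta}+\nu_i+\varepsilon_i$, $i=1,\dots,n$, with $\bm{\beta}\in\mathbb{R}^p$ the vector of regression coefficients, $\mathbf{x}_i\in\mathbb{R}^p$ predictors having a certain distribution $F_{\mathbf{x}}$, $\nu_i$ a random intercept and $\varepsilon_i$ an error, where $(\nu_i,\varepsilon_i)$ is independent of $\mathbf{x}_i$ and $\varepsilon_i$ is independent of $\nu_i$; the pairs $(\mathbf{x}_i,y_i)$ are independent across $i$. The data consist of $k$ consecutive samples (groups), the $j$th of size $n_j$, with $\sum_{j=1}^k n_j=n$. For every index $i$ in the $j$th sample, $\nu_i$ follows the one-point distribution at $c_j$, where $c_j\in[\underline{\mu},\overline{\mu}]$ with $\underline{\mu}=\min_{1\le j\le k} c_j$ and $\overline{\mu}=\max_{1\le j\le k} c_j$, and $\varepsilon_i\sim\mathcal{N}(0,\sigma_j^2)$ with $\sigma_j\in[\underline{\sigma},\overline{\sigma}]$, $0<\underline{\sigma}\le\overline{\sigma}<\infty$. The number of samples and the locations of the change points between them are not known. Windows. $n_0$ is a positive integer (small window size) with $n_0<\min_{1\le j\le k} n_j$, and $T=n/n_0$. The $j$th window is the index set $\{1+(j-1)n_0,\dots,jn_0\}$, $1\le j\le T$. Divisibility of each $n_j$ by $n_0$ ensures that each window lies within a single sample. EM estimator. Starting from an initial $\bm{\beta}^{(0)}$, the algorithm alternates: (E-step) given $\bm{\beta}^{(s)}$, set $a_j=\frac1{n_0}\sum_{i=1+(j-1)n_0}^{jn_0}(y_i-\mathbf{x}_i^{\top}\bm{\beta}^{(s)})$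 and $\nu_i^{(s+1)}=a_j$ for all $i$ in window $j$, $1\le j\le T$; (M-step) let $\bm{\beta}^{(s+1)}$ minimize $\sum_{i=1}^n\{y_i-(\mathbf{x}_i^{\top}\bm{\beta}+\nu_i^{(s+1)})\}^2$ over $\bm{\beta}$, i.e. solve $\sum_{i=1}^n\{y_i-(\mathbf{x}_i^{\top}\bm{\beta}^{(s+1)}+\nu_i^{(s+1)})\}\mathbf{x}_i=\mathbf{0}$. The EM estimator $\hat{\bm{\beta}}_{\mathrm{EM}}$ is the value upon convergence, which together with numbers $\hat a_1,\dots,\hat a_T$ satisfies both $$\sum_{i=1+(j-1)n_0}^{jn_0}(y_i-\hat a_j-\mathbf{x}_i^{\top}\hat{\bm{\beta}}_{\mathrm{EM}})=0\ (1\le j\le T),\qquad \sum_{j=1}^T\sum_{i=1+(j-1)n_0}^{jn_0}(y_i-\hat a_j-\mathbf{x}_i^{\top}\hat{\bm{\beta}}_{\mathrm{EM}})\mathbf{x}_i=\mathbf{0}.$$ *)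

theory Defs
  imports "HOL-Probability.Probability"
begin

section \<open>The k-sample regression model\<close>

text \<open>
  The library's \<^term>\<open>prob_space.indep_var\<close> forces both variables into the same value type; this is
  its characterisation \<open>indep_var_eq\<close> for two possibly different value types.
\<close>

definition (in prob_space) indep_rv ::
  "'b measure \<Rightarrow> ('a \<Rightarrow> 'b) \<Rightarrow> 'c measure \<Rightarrow> ('a \<Rightarrow> 'c) \<Rightarrow> bool" where
  "indep_rv S X T Y \<longleftrightarrow>
     random_variable S X \<and> random_variable T Y \<and>
     indep_set {X -` A \<inter> space M | A. A \<in> sets S} {Y -` B \<inter> space M | B. B \<in> sets T}"

text \<open>Indices of the \<open>j\<close>th of the consecutive samples of sizes \<open>m 1, m 2, \<dots>\<close>; observations and
  samples are numbered from 1.\<close>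

definition sample_idx :: "(nat \<Rightarrow> nat) \<Rightarrow> nat \<Rightarrow> nat set" where
  "sample_idx m j = {(\<Sum>l = 1..<j. m l)<..(\<Sum>l = 1..j. m l)}"

locale k_sample_regression = prob_space M
  for M :: "'w measure" +
  fixes k :: nat
    and m :: "nat \<Rightarrow> nat"
    and n :: nat
    and F :: "(real ^ 'p) measure"
    and x :: "nat \<Rightarrow> 'w \<Rightarrow> real ^ 'p"
    and \<nu> \<epsilon> y :: "nat \<Rightarrow> 'w \<Rightarrow> real"
    and \<beta> :: "real ^ 'p"
    and c \<sigma> :: "nat \<Rightarrow> real"
    and \<mu>_lo \<mu>_hi \<sigma>_lo \<sigma>_hi :: real
  assumes k_pos: "1 \<le> k"
    and n_eq: "n = (\<Sum>j = 1..k. m j)"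
    and mu_lo: "\<mu>_lo = Min (c ` {1..k})"
    and mu_hi: "\<mu>_hi = Max (c ` {1..k})"
    and c_range: "\<And>j. j \<in> {1..k} \<Longrightarrow> c j \<in> {\<mu>_lo..\<mu>_hi}"
    and sigma_bounds: "0 < \<sigma>_lo" "\<sigma>_lo \<le> \<sigma>_hi"
    and sigma_range: "\<And>j. j \<in> {1..k} \<Longrightarrow> \<sigma> j \<in> {\<sigma>_lo..\<sigma>_hi}"
    and model: "\<And>i \<omega>. i \<in> {1..n} \<Longrightarrow> \<omega> \<in> space M \<Longrightarrow> y i \<omega> = x i \<omega> \<bullet> \<beta> + \<nu> i \<omega> + \<epsilon> i \<omega>"
    and x_distr: "\<And>i. i \<in> {1..n} \<Longrightarrow> distr M borel (x i) = F"
    and indep_x: "\<And>i. i \<in> {1..n} \<Longrightarrow> indep_rv borel (\<lambda>\<omega>. (\<nu> i \<omega>, \<epsilon> i \<omega>)) borel (x i)"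
    and indep_noise: "\<And>i. i \<in> {1..n} \<Longrightarrow> indep_var borel (\<epsilon> i) borel (\<nu> i)"
    and indep_obs: "indep_vars (\<lambda>_. borel) (\<lambda>i \<omega>. (x i \<omega>, y i \<omega>)) {1..n}"
    and nu_distr: "\<And>i j. j \<in> {1..k} \<Longrightarrow> i \<in> sample_idx m j \<Longrightarrow>
          distr M borel (\<nu> i) = return borel (c j)"
    and eps_distr: "\<And>i j. j \<in> {1..k} \<Longrightarrow> i \<in> sample_idx m j \<Longrightarrow>
          distributed M lborel (\<epsilon> i) (normal_density 0 (\<sigma> j))"

section \<open>Windows and the EM algorithm\<close>

definition window :: "nat \<Rightarrow> nat \<Rightarrow> nat set" where
  "window n0 j = {1 + (j - 1) * n0..j * n0}"

definition window_mean :: "nat \<Rightarrow> (nat \<Rightarrow> 'a::real_vector) \<Rightarrow> nat \<Rightarrow> 'a" where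
  "window_mean n0 f j = (1 / real n0) *\<^sub>R (\<Sum>i\<in>window n0 j. f i)"

text \<open>\<open>em_step n n0 x y b b'\<close>: one E-step followed by one M-step may lead from \<open>b\<close> to \<open>b'\<close>. It is a
  relation because the least-squares problem of the M-step can have several minimisers.\<close>

definition em_step ::
  "nat \<Rightarrow> nat \<Rightarrow> (nat \<Rightarrow> real ^ 'p) \<Rightarrow> (nat \<Rightarrow> real) \<Rightarrow> real ^ 'p \<Rightarrow> real ^ 'p \<Rightarrow> bool" where
  "em_step n n0 x y b b' \<longleftrightarrow>
     (\<exists>v :: nat \<Rightarrow> real.
        (\<forall>j\<in>{1..n div n0}. \<forall>i\<in>window n0 j. v i = window_mean n0 (\<lambda>l. y l - x l \<bullet> b) j) \<and>
        is_arg_min (\<lambda>\<gamma>. \<Sum>i = 1..n. (y i - (x i \<bullet> \<gamma> + v i))\<^sup>2) (\<lambda>_. True) b')"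

text \<open>The value upon convergence of a run of the algorithm, from some initial value.\<close>

definition em_estimator ::
  "nat \<Rightarrow> nat \<Rightarrow> (nat \<Rightarrow> real ^ 'p) \<Rightarrow> (nat \<Rightarrow> real) \<Rightarrow> real ^ 'p \<Rightarrow> bool" where
  "em_estimator n n0 x y b \<longleftrightarrow>
     (\<exists>B. (\<forall>s. em_step n n0 x y (B s) (B (Suc s))) \<and> B \<longlonglongrightarrow> b)"

definition em_equations ::
  "nat \<Rightarrow> nat \<Rightarrow> (nat \<Rightarrow> real ^ 'p) \<Rightarrow> (nat \<Rightarrow> real) \<Rightarrow> (nat \<Rightarrow> real) \<Rightarrow> real ^ 'p \<Rightarrow> bool" where
  "em_equations n n0 x y a b \<longleftrightarrow>
     (\<forall>j\<in>{1..n div n0}. (\<Sum>i\<in>window n0 j. y i - a j - x i \<bullet> b) = 0) \<and>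
     (\<Sum>j = 1..n div n0. \<Sum>i\<in>window n0 j. (y i - a j - x i \<bullet> b) *\<^sub>R x i) = 0"

definition outer_prod :: "real ^ 'p \<Rightarrow> real ^ 'p \<Rightarrow> real ^ 'p ^ 'p" where
  "outer_prod u v = (\<chi> r s. u $ r * v $ s)"

definition window_scatter :: "nat \<Rightarrow> nat \<Rightarrow> (nat \<Rightarrow> real ^ 'p) \<Rightarrow> real ^ 'p ^ 'p" where
  "window_scatter n n0 x =
     (\<Sum>j = 1..n div n0. \<Sum>i\<in>window n0 j.
        outer_prod (x i - window_mean n0 x j) (x i - window_mean n0 x j))"

end

theory Submission
  imports Defs
begin

text \<open>
  Along almost every outcome the random intercept equals the constant \<open>c l\<close> throughout the \<open>l\<close>th
  sample, and divisibility of the sample sizes by the window size puts every window inside one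
  sample (\<open>window_in_sample\<close>). So the intercept is constant on each window, and subtracting window
  means from the response removes it. From there on the argument is deterministic.

  Eliminating the intercept estimates from the estimating equations leaves one equation in the
  coefficient \<open>b\<close>: the residuals \<open>y i - x i \<bullet> b\<close>, centred within windows, are orthogonal to the
  predictors. Since centring is a symmetric idempotent operation it can be moved onto the predictors,
  and the equation becomes the linear system \<open>S *v (b - \<beta>) = e\<close> (\<open>centred_score_eq\<close>), where \<open>S\<close> is
  the scatter matrix within windows and \<open>e\<close> the sum of the centred predictors weighted by the errors.
  For invertible \<open>S\<close> the closed form is its only solution.

  The algorithm leads to the same equation. Least squares minimisers are the solutions of the normal
  equations (\<open>least_squares_iff_normal_equations\<close>), which makes one step of the algorithm a
  linear equation between consecutive iterates. Its limit is the equation above, so a limit of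
  iterates can only be the closed form; conversely, the closed form is a fixed point of the
  algorithm, hence the limit of the constant run.
\<close>

section \<open>Windows\<close>

lemma finite_window [simp]: "finite (window n0 j)"
  by (simp add: window_def)

lemma card_window: "1 \<le> j \<Longrightarrow> card (window n0 j) = n0"
  by (cases j) (auto simp: window_def)

lemma window_end_le:
  fixes j n n0 :: nat
  assumes "j \<in> {1..n div n0}"
  shows "j * n0 \<le> n"
proof -
  have "j * n0 \<le> (n div n0) * n0"
    using assms by (intro mult_le_mono1) simp
  also have "\<dots> \<le> n"
    by (rule div_times_less_eq_dividend)
  finally show ?thesis .
qed

lemma sum_windows:
  fixes f :: "nat \<Rightarrow> 'a::comm_monoid_add"
  shows "(\<Sum>j = 1..T. \<Sum>i\<in>window n0 j. f i) = (\<Sum>i = 1..T * n0. f i)"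
proof (induction T)
  case (Suc T)
  have "{1..Suc T * n0} = {1..T * n0} \<union> window n0 (Suc T)"
    by (auto simp: window_def)
  moreover have "{1..T * n0} \<inter> window n0 (Suc T) = {}"
    by (auto simp: window_def)
  ultimately show ?case
    using Suc.IH by (simp add: sum.union_disjoint)
qed simp

lemma window_number:
  assumes "1 \<le> j" "i \<in> window n0 j"
  shows "Suc ((i - 1) div n0) = j"
proof -
  obtain j' where j': "j = Suc j'"
    using assms(1) by (cases j) auto
  have "j' * n0 \<le> i - 1" "i - 1 < Suc j' * n0"
    using assms(2) by (auto simp: window_def j')
  hence "(i - 1) div n0 = j'"
    by (intro div_nat_eqI) (auto simp: mult.commute)
  thus ?thesis
    by (simp add: j')
qed

text \<open>
  The last index of the window, \<open>j * n0\<close>, lies in some sample. The samples before that one end at a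
  multiple of \<open>n0\<close> which is smaller than \<open>j * n0\<close>, hence no later than the start of the window.
\<close>

lemma window_in_sample:
  assumes dvd: "\<And>l. l \<in> {1..k} \<Longrightarrow> n0 dvd m l"
    and n0: "0 < n0" and j: "1 \<le> j" "j * n0 \<le> (\<Sum>l = 1..k. m l)"
  obtains l where "l \<in> {1..k}" "window n0 j \<subseteq> sample_idx m l"
proof -
  define P where "P l \<longleftrightarrow> j * n0 \<le> (\<Sum>i = 1..l. m i)" for l
  define l where "l = (LEAST l. P l)"
  have "P k"
    using j by (simp add: P_def)
  hence Pl: "P l" and "l \<le> k"
    unfolding l_def by (auto intro: LeastI Least_le)
  have "l \<noteq> 0"
    using Pl n0 j(1) by (intro notI) (simp add: P_def)
  then obtain l' where l': "l = Suc l'"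
    by (cases l) auto
  have "\<not> P l'"
    using not_less_Least[of l' P] by (simp add: l'[unfolded l_def])
  hence less: "(\<Sum>i = 1..l'. m i) < j * n0"
    by (simp add: P_def)
  have "n0 dvd (\<Sum>i = 1..l'. m i)"
    using \<open>l \<le> k\<close> by (intro dvd_sum dvd) (auto simp: l')
  then obtain q where q: "(\<Sum>i = 1..l'. m i) = q * n0"
    by (metis dvd_def mult.commute)
  have "q < j"
    using less n0 unfolding q by simp
  hence "q \<le> j - 1"
    by simp
  hence "(\<Sum>i = 1..l'. m i) \<le> (j - 1) * n0"
    unfolding q by (rule mult_le_mono1)
  hence "window n0 j \<subseteq> sample_idx m l"
    using Pl by (auto simp: window_def sample_idx_def P_def l' atLeastLessThanSuc_atLeastAtMost)
  thus ?thesis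
    using that[of l] \<open>l \<le> k\<close> by (auto simp: l')
qed

section \<open>Centring within windows\<close>

lemma sum_window_eq_mean:
  assumes "0 < n0"
  shows "(\<Sum>i\<in>window n0 j. f i) = real n0 *\<^sub>R window_mean n0 f j"
  using assms by (simp add: window_mean_def)

lemma sum_window_centred:
  assumes "0 < n0" "1 \<le> j"
  shows "(\<Sum>i\<in>window n0 j. f i - window_mean n0 f j) = 0"
  using assms
  by (simp add: sum_subtractf sum_window_eq_mean card_window scaleR_conv_of_real
      sum_constant_scaleR)

text \<open>
  The following two identities say that centring is symmetric and idempotent: in a sum of products it
  makes no difference which factor is centred, or whether both are, because the centred factor sums
  to zero against the constant mean of the other one.
\<close>

lemma centring_idempotent:
  fixes x :: "nat \<Rightarrow> 'a::real_vector"
  assumes "0 < n0" "1 \<le> j"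
  shows "(\<Sum>i\<in>window n0 j. (u i - window_mean n0 u j) *\<^sub>R (x i - window_mean n0 x j))
       = (\<Sum>i\<in>window n0 j. u i *\<^sub>R (x i - window_mean n0 x j))"
proof -
  have "(\<Sum>i\<in>window n0 j. (u i - window_mean n0 u j) *\<^sub>R (x i - window_mean n0 x j))
      = (\<Sum>i\<in>window n0 j. u i *\<^sub>R (x i - window_mean n0 x j))
        - window_mean n0 u j *\<^sub>R (\<Sum>i\<in>window n0 j. x i - window_mean n0 x j)"
    by (simp add: scaleR_left_diff_distrib sum_subtractf flip: scaleR_sum_right)
  thus ?thesis
    by (simp only: sum_window_centred[OF assms]) simp
qed

lemma centring_symmetric:
  fixes x :: "nat \<Rightarrow> 'a::real_vector"
  assumes "0 < n0" "1 \<le> j"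
  shows "(\<Sum>i\<in>window n0 j. (u i - window_mean n0 u j) *\<^sub>R x i)
       = (\<Sum>i\<in>window n0 j. u i *\<^sub>R (x i - window_mean n0 x j))"
proof -
  have "(\<Sum>i\<in>window n0 j. (u i - window_mean n0 u j) *\<^sub>R (x i - window_mean n0 x j))
      = (\<Sum>i\<in>window n0 j. (u i - window_mean n0 u j) *\<^sub>R x i)
        - (\<Sum>i\<in>window n0 j. u i - window_mean n0 u j) *\<^sub>R window_mean n0 x j"
    unfolding scaleR_right_diff_distrib scaleR_sum_left by (rule sum_subtractf)
  thus ?thesis
    by (simp only: sum_window_centred[OF assms] centring_idempotent[OF assms]) simp
qed

lemma window_mean_cong:
  "(\<And>i. i \<in> window n0 j \<Longrightarrow> f i = g i) \<Longrightarrow> window_mean n0 f j = window_mean n0 g j"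
  by (simp add: window_mean_def)

lemma window_mean_add_const:
  assumes "0 < n0" "1 \<le> j"
  shows "window_mean n0 (\<lambda>i. a + f i) j = a + window_mean n0 f j"
  using assms by (simp add: window_mean_def sum.distrib card_window sum_constant_scaleR
      scaleR_right_distrib)

lemma window_mean_inner:
  "window_mean n0 (\<lambda>i. x i \<bullet> b) j = window_mean n0 x j \<bullet> b"
  by (simp add: window_mean_def inner_sum_left)

lemma matrix_vector_mult_sum_left: "sum A I *v d = (\<Sum>i\<in>I. A i *v d)"
  by (induction I rule: infinite_finite_induct) (auto simp: matrix_vector_mult_add_rdistrib)

lemma outer_prod_mult_vec: "outer_prod u v *v d = (v \<bullet> d) *\<^sub>R u"
  by (simp add: vec_eq_iff outer_prod_def matrix_vector_mult_def inner_vec_def sum_distrib_left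
      sum_distrib_right mult_ac)

lemma window_scatter_mult_vec:
  assumes "0 < n0"
  shows "window_scatter n n0 x *v d
       = (\<Sum>j = 1..n div n0. \<Sum>i\<in>window n0 j. (x i \<bullet> d) *\<^sub>R (x i - window_mean n0 x j))"
proof -
  have "window_scatter n n0 x *v d
      = (\<Sum>j = 1..n div n0. \<Sum>i\<in>window n0 j.
           (x i \<bullet> d - window_mean n0 (\<lambda>i. x i \<bullet> d) j) *\<^sub>R (x i - window_mean n0 x j))"
    by (simp add: window_scatter_def matrix_vector_mult_sum_left outer_prod_mult_vec
        inner_diff_left window_mean_inner)
  also have "\<dots> = (\<Sum>j = 1..n div n0. \<Sum>i\<in>window n0 j. (x i \<bullet> d) *\<^sub>R (x i - window_mean n0 x j))"
    using assms by (intro sum.cong refl centring_idempotent) auto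
  finally show ?thesis .
qed

section \<open>The estimating equation for the coefficient\<close>

text \<open>
  The two arguments \<open>b\<close> and \<open>b'\<close> separate the coefficient that determines the intercepts in the
  E-step from the coefficient fitted in the M-step; the estimating equations have \<open>b = b'\<close>.
\<close>

definition em_score ::
  "nat \<Rightarrow> nat \<Rightarrow> (nat \<Rightarrow> real ^ 'p) \<Rightarrow> (nat \<Rightarrow> real) \<Rightarrow> real ^ 'p \<Rightarrow> real ^ 'p \<Rightarrow> real ^ 'p" where
  "em_score n n0 x y b b' = (\<Sum>j = 1..n div n0. \<Sum>i\<in>window n0 j.
     (y i - window_mean n0 (\<lambda>l. y l - x l \<bullet> b) j - x i \<bullet> b') *\<^sub>R x i)"

lemma em_equations_iff_em_score:
  assumes n0: "0 < n0"
  shows "(\<exists>a. em_equations n n0 x y a b) \<longleftrightarrow> em_score n n0 x y b b = 0"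
proof -
  \<comment> \<open>The equation of each window determines its intercept.\<close>
  have mean: "(\<Sum>i\<in>window n0 j. y i - a - x i \<bullet> b) = 0
          \<longleftrightarrow> a = window_mean n0 (\<lambda>l. y l - x l \<bullet> b) j" if "1 \<le> j" for j a
  proof -
    have "(\<Sum>i\<in>window n0 j. y i - a - x i \<bullet> b)
        = (\<Sum>i\<in>window n0 j. y i - x i \<bullet> b) - real n0 * a"
      using card_window[OF that, of n0] by (simp add: sum_subtractf)
    also have "\<dots> = real n0 * (window_mean n0 (\<lambda>l. y l - x l \<bullet> b) j - a)"
      by (simp only: sum_window_eq_mean[OF n0] right_diff_distrib real_scaleR_def)
    finally show ?thesis
      using n0 by auto
  qed
  have "em_equations n n0 x y a b \<longleftrightarrow>
      (\<forall>j\<in>{1..n div n0}. a j = window_mean n0 (\<lambda>l. y l - x l \<bullet> b) j) \<and>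
      em_score n n0 x y b b = 0" for a
  proof -
    have eqs: "(\<forall>j\<in>{1..n div n0}. (\<Sum>i\<in>window n0 j. y i - a j - x i \<bullet> b) = 0) \<longleftrightarrow>
        (\<forall>j\<in>{1..n div n0}. a j = window_mean n0 (\<lambda>l. y l - x l \<bullet> b) j)"
      by (intro ball_cong refl mean) auto
    show ?thesis
      unfolding em_equations_def eqs em_score_def by (intro conj_cong refl) auto
  qed
  thus ?thesis
    by (auto intro!: exI[of _ "\<lambda>j. window_mean n0 (\<lambda>l. y l - x l \<bullet> b) j"])
qed

text \<open>
  In the residual \<open>y i - x i \<bullet> b\<close>, the intercept is absorbed by the window mean, so only the error
  minus \<open>x i \<bullet> (b - \<beta>)\<close> survives centring; then the centring is moved onto the predictor.
\<close>

lemma centred_score_eq: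
  assumes n0: "0 < n0"
    and model: "\<And>j i. j \<in> {1..n div n0} \<Longrightarrow> i \<in> window n0 j \<Longrightarrow> y i = x i \<bullet> \<beta> + a j + e i"
  shows "em_score n n0 x y b b
       = (\<Sum>j = 1..n div n0. \<Sum>i\<in>window n0 j. e i *\<^sub>R (x i - window_mean n0 x j))
         - window_scatter n n0 x *v (b - \<beta>)"
proof -
  define w where "w i = e i - x i \<bullet> (b - \<beta>)" for i
  have "em_score n n0 x y b b
      = (\<Sum>j = 1..n div n0. \<Sum>i\<in>window n0 j. w i *\<^sub>R (x i - window_mean n0 x j))"
    unfolding em_score_def
  proof (rule sum.cong[OF refl])
    fix j assume j: "j \<in> {1..n div n0}"
    hence j1: "1 \<le> j"
      by simp
    have resid: "y i - x i \<bullet> b = a j + w i" if "i \<in> window n0 j" for i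
      using model[OF j that] by (simp add: w_def inner_diff_right)
    have mean: "window_mean n0 (\<lambda>l. y l - x l \<bullet> b) j = a j + window_mean n0 w j"
      by (simp add: window_mean_cong[OF resid] window_mean_add_const[OF n0 j1])
    have "(\<Sum>i\<in>window n0 j. (y i - window_mean n0 (\<lambda>l. y l - x l \<bullet> b) j - x i \<bullet> b) *\<^sub>R x i)
        = (\<Sum>i\<in>window n0 j. (w i - window_mean n0 w j) *\<^sub>R x i)"
    proof (rule sum.cong[OF refl])
      fix i assume "i \<in> window n0 j"
      from resid[OF this]
      have "y i - window_mean n0 (\<lambda>l. y l - x l \<bullet> b) j - x i \<bullet> b = w i - window_mean n0 w j"
        by (simp add: mean)
      thus "(y i - window_mean n0 (\<lambda>l. y l - x l \<bullet> b) j - x i \<bullet> b) *\<^sub>R x i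
          = (w i - window_mean n0 w j) *\<^sub>R x i"
        by simp
    qed
    also have "\<dots> = (\<Sum>i\<in>window n0 j. w i *\<^sub>R (x i - window_mean n0 x j))"
      by (rule centring_symmetric[OF n0 j1])
    finally show "(\<Sum>i\<in>window n0 j.
          (y i - window_mean n0 (\<lambda>l. y l - x l \<bullet> b) j - x i \<bullet> b) *\<^sub>R x i) = \<dots>" .
  qed
  thus ?thesis
    by (simp add: window_scatter_mult_vec[OF n0] w_def scaleR_left_diff_distrib sum_subtractf)
qed

lemma invertible_mult_vec_eq_iff:
  fixes A :: "real ^ 'p ^ 'p"
  assumes "invertible A"
  shows "A *v d = e \<longleftrightarrow> d = matrix_inv A *v e"
proof -
  have "A ** matrix_inv A = mat 1 \<and> matrix_inv A ** A = mat 1"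
    unfolding matrix_inv_def using assms unfolding invertible_def by (rule someI_ex)
  thus ?thesis
    by (metis matrix_vector_mul_assoc matrix_vector_mul_lid)
qed

section \<open>Least squares\<close>

text \<open>
  The objective is a quadratic function of the displacement \<open>h\<close>; its linear part is \<open>-2\<close> times the inner
  product of \<open>h\<close> with the score \<open>r\<close>. If \<open>r = 0\<close>, moving only adds a sum of squares. Otherwise a short
  move along \<open>r\<close> lowers the objective, and \<open>t\<close> below is short enough for that.
\<close>

lemma least_squares_iff_normal_equations:
  fixes x :: "'i \<Rightarrow> 'a::real_inner"
  shows "is_arg_min (\<lambda>\<gamma>. \<Sum>i\<in>I. (z i - x i \<bullet> \<gamma>)\<^sup>2) (\<lambda>_. True) b
     \<longleftrightarrow> (\<Sum>i\<in>I. (z i - x i \<bullet> b) *\<^sub>R x i) = 0"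
proof -
  define f where "f \<gamma> = (\<Sum>i\<in>I. (z i - x i \<bullet> \<gamma>)\<^sup>2)" for \<gamma>
  define r where "r = (\<Sum>i\<in>I. (z i - x i \<bullet> b) *\<^sub>R x i)"
  define Q where "Q h = (\<Sum>i\<in>I. (x i \<bullet> h)\<^sup>2)" for h
  have Q_nonneg: "0 \<le> Q h" for h
    by (simp add: Q_def sum_nonneg)
  have expand: "f (b + h) = f b - 2 * (r \<bullet> h) + Q h" for h
  proof -
    have "(z i - x i \<bullet> (b + h))\<^sup>2
        = (z i - x i \<bullet> b)\<^sup>2 - 2 * ((z i - x i \<bullet> b) * (x i \<bullet> h)) + (x i \<bullet> h)\<^sup>2" for i
      by (simp add: inner_add_right power2_eq_square algebra_simps)
    thus ?thesis
      by (simp add: f_def r_def Q_def sum.distrib sum_subtractf sum_distrib_left inner_sum_left)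
  qed
  have "(\<forall>\<gamma>. f b \<le> f \<gamma>) \<longleftrightarrow> r = 0"
  proof
    assume "r = 0"
    show "\<forall>\<gamma>. f b \<le> f \<gamma>"
    proof
      fix \<gamma>
      show "f b \<le> f \<gamma>"
        using expand[of "\<gamma> - b"] Q_nonneg[of "\<gamma> - b"] by (simp add: \<open>r = 0\<close>)
    qed
  next
    assume min: "\<forall>\<gamma>. f b \<le> f \<gamma>"
    define N where "N = r \<bullet> r"
    define t where "t = N / (Q r + 1)"
    have pos: "0 < Q r + 1"
      using Q_nonneg[of r] by simp
    have tN: "t * (Q r + 1) = N"
      using pos by (simp add: t_def)
    have "Q (t *\<^sub>R r) = t\<^sup>2 * Q r"
      by (simp add: Q_def power_mult_distrib sum_distrib_left)
    hence "2 * (t * N) \<le> t\<^sup>2 * Q r"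
      using min[rule_format, of "b + t *\<^sub>R r"] expand[of "t *\<^sub>R r"] by (simp add: N_def)
    also have "\<dots> = t * N - t\<^sup>2"
      by (simp add: tN[symmetric] power2_eq_square algebra_simps)
    finally have "t * N + t\<^sup>2 \<le> 0"
      by linarith
    moreover have "t * N = t\<^sup>2 * (Q r + 1)"
      by (simp add: tN[symmetric] power2_eq_square)
    hence "0 \<le> t * N"
      using pos by simp
    ultimately have "t\<^sup>2 \<le> 0"
      by linarith
    hence "N = 0"
      using tN by auto
    thus "r = 0"
      by (simp add: N_def)
  qed
  thus ?thesis
    by (auto simp: is_arg_min_linorder f_def r_def)
qed

section \<open>The algorithm\<close>

lemma em_step_iff_em_score:
  assumes n0: "0 < n0" and n: "n0 dvd n"
  shows "em_step n n0 x y b b' \<longleftrightarrow> em_score n n0 x y b b' = 0"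
proof -
  define \<phi> where "\<phi> v \<longleftrightarrow>
    (\<forall>j\<in>{1..n div n0}. \<forall>i\<in>window n0 j. v i = window_mean n0 (\<lambda>l. y l - x l \<bullet> b) j)"
    for v :: "nat \<Rightarrow> real"
  have step: "is_arg_min (\<lambda>\<gamma>. \<Sum>i = 1..n. (y i - (x i \<bullet> \<gamma> + v i))\<^sup>2) (\<lambda>_. True) b'
          \<longleftrightarrow> em_score n n0 x y b b' = 0" if v: "\<phi> v" for v
  proof -
    have "is_arg_min (\<lambda>\<gamma>. \<Sum>i = 1..n. (y i - (x i \<bullet> \<gamma> + v i))\<^sup>2) (\<lambda>_. True) b'
       \<longleftrightarrow> (\<Sum>i = 1..n. (y i - v i - x i \<bullet> b') *\<^sub>R x i) = 0"
      using least_squares_iff_normal_equations[of "\<lambda>i. y i - v i" x "{1..n}" b']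
      by (simp add: algebra_simps)
    also have "(\<Sum>i = 1..n. (y i - v i - x i \<bullet> b') *\<^sub>R x i)
        = (\<Sum>j = 1..n div n0. \<Sum>i\<in>window n0 j. (y i - v i - x i \<bullet> b') *\<^sub>R x i)"
      unfolding sum_windows using n by simp
    also have "\<dots> = em_score n n0 x y b b'"
      unfolding em_score_def using v by (intro sum.cong refl) (simp add: \<phi>_def)
    finally show ?thesis .
  qed
  \<comment> \<open>The E-step is always possible: every index knows its window.\<close>
  have "\<phi> (\<lambda>i. window_mean n0 (\<lambda>l. y l - x l \<bullet> b) (Suc ((i - 1) div n0)))"
    unfolding \<phi>_def
  proof (intro ballI)
    fix j i assume "j \<in> {1..n div n0}" and i: "i \<in> window n0 j"
    hence "1 \<le> j"
      by simp
    show "window_mean n0 (\<lambda>l. y l - x l \<bullet> b) (Suc ((i - 1) div n0))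
        = window_mean n0 (\<lambda>l. y l - x l \<bullet> b) j"
      by (simp only: window_number[OF \<open>1 \<le> j\<close> i])
  qed
  moreover have "em_step n n0 x y b b' \<longleftrightarrow> (\<exists>v. \<phi> v \<and>
      is_arg_min (\<lambda>\<gamma>. \<Sum>i = 1..n. (y i - (x i \<bullet> \<gamma> + v i))\<^sup>2) (\<lambda>_. True) b')"
    by (simp add: em_step_def \<phi>_def)
  ultimately show ?thesis
    using step by blast
qed

lemma tendsto_em_score:
  assumes "B \<longlonglongrightarrow> b" "B' \<longlonglongrightarrow> b'"
  shows "(\<lambda>s. em_score n n0 x y (B s) (B' s)) \<longlonglongrightarrow> em_score n n0 x y b b'"
  unfolding em_score_def window_mean_def by (intro tendsto_intros assms)

text \<open>
  Consecutive iterates satisfy the step equation, which survives in the limit with both arguments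
  equal. Conversely, a solution is reproduced by the algorithm when it is the initial value.
\<close>

lemma em_estimator_iff_em_score:
  assumes n0: "0 < n0" and n: "n0 dvd n"
  shows "em_estimator n n0 x y b \<longleftrightarrow> em_score n n0 x y b b = 0"
proof
  assume "em_estimator n n0 x y b"
  then obtain B where step: "\<And>s. em_step n n0 x y (B s) (B (Suc s))" and lim: "B \<longlonglongrightarrow> b"
    by (auto simp: em_estimator_def)
  have "(\<lambda>s. em_score n n0 x y (B s) (B (Suc s))) \<longlonglongrightarrow> em_score n n0 x y b b"
    using lim by (intro tendsto_em_score LIMSEQ_Suc)
  moreover have "em_score n n0 x y (B s) (B (Suc s)) = 0" for s
    using step by (simp add: em_step_iff_em_score[OF n0 n])
  ultimately show "em_score n n0 x y b b = 0"
    by (simp add: LIMSEQ_const_iff)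
next
  assume "em_score n n0 x y b b = 0"
  thus "em_estimator n n0 x y b"
    unfolding em_estimator_def em_step_iff_em_score[OF n0 n]
    by (intro exI[of _ "\<lambda>_. b"]) simp
qed

section \<open>The random intercept\<close>

lemma (in prob_space) AE_eq_of_distr_return:
  fixes X :: "'a \<Rightarrow> real"
  assumes [measurable]: "X \<in> borel_measurable M" and "distr M borel X = return borel c"
  shows "AE \<omega> in M. X \<omega> = c"
proof -
  have "AE z in distr M borel X. z = c"
    unfolding assms(2) by (subst AE_return) auto
  thus ?thesis
    by (subst (asm) AE_distr_iff) auto
qed

lemma (in k_sample_regression) AE_intercept_const_on_windows:
  assumes n0: "0 < n0" and dvd: "\<And>j. j \<in> {1..k} \<Longrightarrow> n0 dvd m j"
  shows "AE \<omega> in M. \<forall>j\<in>{1..n div n0}. \<exists>a. \<forall>i\<in>window n0 j. \<nu> i \<omega> = a"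
proof -
  have "AE \<omega> in M. \<exists>a. \<forall>i\<in>window n0 j. \<nu> i \<omega> = a" if j: "j \<in> {1..n div n0}" for j
  proof -
    have jn: "j * n0 \<le> n"
      using j by (rule window_end_le)
    obtain l where l: "l \<in> {1..k}" "window n0 j \<subseteq> sample_idx m l"
      using window_in_sample[of k n0 m j] dvd n0 j jn by (auto simp: n_eq)
    have "AE \<omega> in M. \<forall>i\<in>window n0 j. \<nu> i \<omega> = c l"
    proof (rule AE_finite_allI)
      fix i assume i: "i \<in> window n0 j"
      hence "i \<in> {1..n}"
        using jn by (auto simp: window_def)
      from indep_noise[OF this] have "\<nu> i \<in> borel_measurable M"
        by (simp add: indep_var_rv2)
      thus "AE \<omega> in M. \<nu> i \<omega> = c l"
        using nu_distr[OF l(1)] l(2) i by (intro AE_eq_of_distr_return) auto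
    qed simp
    thus ?thesis
      by eventually_elim blast
  qed
  thus ?thesis
    by (intro AE_finite_allI) auto
qed

section \<open>The closed form\<close>

theorem lemma1:
  fixes M :: "'w measure"
    and k :: nat and m :: "nat \<Rightarrow> nat" and n n0 :: nat
    and F :: "(real ^ 'p) measure"
    and x :: "nat \<Rightarrow> 'w \<Rightarrow> real ^ 'p"
    and \<nu> \<epsilon> y :: "nat \<Rightarrow> 'w \<Rightarrow> real"
    and \<beta> :: "real ^ 'p"
    and c \<sigma> :: "nat \<Rightarrow> real"
    and \<mu>_lo \<mu>_hi \<sigma>_lo \<sigma>_hi :: real
  assumes "k_sample_regression M k m n F x \<nu> \<epsilon> y \<beta> c \<sigma> \<mu>_lo \<mu>_hi \<sigma>_lo \<sigma>_hi"
    and "0 < n0"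
    and "n0 < Min (m ` {1..k})"
    and "\<And>j. j \<in> {1..k} \<Longrightarrow> n0 dvd m j"
  shows "AE \<omega> in M.
    invertible (window_scatter n n0 (\<lambda>i. x i \<omega>)) \<longrightarrow>
    (let \<beta>_EM = \<beta> + matrix_inv (window_scatter n n0 (\<lambda>i. x i \<omega>)) *v
           (\<Sum>j = 1..n div n0. \<Sum>i\<in>window n0 j.
              \<epsilon> i \<omega> *\<^sub>R (x i \<omega> - window_mean n0 (\<lambda>l. x l \<omega>) j))
     in \<forall>b. (em_estimator n n0 (\<lambda>i. x i \<omega>) (\<lambda>i. y i \<omega>) b \<longleftrightarrow> b = \<beta>_EM) \<and>
            ((\<exists>a. em_equations n n0 (\<lambda>i. x i \<omega>) (\<lambda>i. y i \<omega>) a b) \<longleftrightarrow> b = \<beta>_EM))"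
proof -
  interpret k_sample_regression M k m n F x \<nu> \<epsilon> y \<beta> c \<sigma> \<mu>_lo \<mu>_hi \<sigma>_lo \<sigma>_hi
    by fact
  note n0 = \<open>0 < n0\<close>
  have n: "n0 dvd n"
    unfolding n_eq using assms(4) by (intro dvd_sum) auto
  have "AE \<omega> in M. \<forall>j\<in>{1..n div n0}. \<exists>a. \<forall>i\<in>window n0 j. \<nu> i \<omega> = a"
    using n0 assms(4) by (rule AE_intercept_const_on_windows)
  thus ?thesis
  proof (rule AE_mp[OF _ AE_I2], intro impI)
    fix \<omega> assume \<omega>: "\<omega> \<in> space M"
    assume "\<forall>j\<in>{1..n div n0}. \<exists>a. \<forall>i\<in>window n0 j. \<nu> i \<omega> = a"
    then obtain a where a: "\<And>j i. j \<in> {1..n div n0} \<Longrightarrow> i \<in> window n0 j \<Longrightarrow> \<nu> i \<omega> = a j"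
      by metis
    let ?x = "\<lambda>i. x i \<omega>" and ?y = "\<lambda>i. y i \<omega>"
    let ?S = "window_scatter n n0 ?x"
    let ?e = "\<Sum>j = 1..n div n0. \<Sum>i\<in>window n0 j. \<epsilon> i \<omega> *\<^sub>R (?x i - window_mean n0 ?x j)"
    assume inv: "invertible ?S"
    have "y i \<omega> = x i \<omega> \<bullet> \<beta> + a j + \<epsilon> i \<omega>" if j: "j \<in> {1..n div n0}" and i: "i \<in> window n0 j"
      for j i
    proof -
      have "j * n0 \<le> n"
        using j by (rule window_end_le)
      hence "i \<in> {1..n}"
        using i by (auto simp: window_def)
      thus ?thesis
        using model \<omega> a[OF j i] by simp
    qed
    hence score: "em_score n n0 ?x ?y b b = ?e - ?S *v (b - \<beta>)" for b
      by (rule centred_score_eq[OF n0])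
    have "em_score n n0 ?x ?y b b = 0 \<longleftrightarrow> b = \<beta> + matrix_inv ?S *v ?e" for b
    proof -
      have "em_score n n0 ?x ?y b b = 0 \<longleftrightarrow> ?S *v (b - \<beta>) = ?e"
        unfolding score right_minus_eq by (rule eq_commute)
      also have "\<dots> \<longleftrightarrow> b - \<beta> = matrix_inv ?S *v ?e"
        by (rule invertible_mult_vec_eq_iff[OF inv])
      also have "\<dots> \<longleftrightarrow> b = \<beta> + matrix_inv ?S *v ?e"
        unfolding diff_eq_eq by (simp only: add.commute)
      finally show ?thesis .
    qed
    thus "let \<beta>_EM = \<beta> + matrix_inv ?S *v ?e
       in \<forall>b. (em_estimator n n0 ?x ?y b \<longleftrightarrow> b = \<beta>_EM) \<and>
              ((\<exists>a. em_equations n n0 ?x ?y a b) \<longleftrightarrow> b = \<beta>_EM)"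
      by (simp add: Let_def em_estimator_iff_em_score[OF n0 n] em_equations_iff_em_score[OF n0])
  qed
qed

end
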